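(* Let $(\Gamma,\pi)$ be the following 2-edge-colored planar graph of girth 4. Its vertices are $a,b,z$ and $x_0,x_1,\dots,x_{11}$. Its edges of color $0$ are $$x_0a,\ ax_2,\ x_2b,\ bx_0,\ x_0x_1,\ x_4x_3,\ x_3a,\ ax_5,\ x_7x_6,\ x_6b,\ bx_8,\ x_{10}x_9,$$ and its edges of color $1$ are $$zx_0,\ x_1x_2,\ x_4x_5,\ x_5b,\ bx_3,\ x_7x_8,\ x_8a,\ ax_6,\ x_{10}x_{11},\ x_{11}a,\ ax_9,\ x_9b,\ bx_{11}.$$ Then $(\Gamma,\pi)$ admits no $3$-inversion.
   Context: A 2-edge-colored graph $(G,\pi)$ is a finite simple graph $G$ with a map $\pi:E(G)\to\mathbb{F}_2$. For a positive integer $t$, a $t$-inversion of $(G,\pi)$ is an assignment of a vector $\mathbf{u}\in\mathbb{F}_2^t$ to each vertex $u\in V(G)$ such that $\pi(uv)=\mathbf{u}\cdot\mathbf{v}$ (standard dot product over $\mathbb{F}_2$) for every edge $uv\in E(G)$. *)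

theory Defs
  imports "HOL-Analysis.Analysis" "HOL-Library.Z2" "HOL-Library.Extended_Nat"
begin

text \<open>
  A graph is a vertex set \<open>V\<close> together with a set \<open>E\<close> of edges, an edge being the two-element set of
  its ends.
\<close>

definition finite_simple_graph :: "'v set \<Rightarrow> 'v set set \<Rightarrow> bool" where
  "finite_simple_graph V E \<longleftrightarrow> finite V \<and> (\<forall>e\<in>E. e \<subseteq> V \<and> card e = 2)"

definition is_cycle :: "'v set set \<Rightarrow> 'v list \<Rightarrow> bool" where
  "is_cycle E c \<longleftrightarrow> length c \<ge> 3 \<and> distinct c \<and>
     (\<forall>i<length c. {c ! i, c ! (Suc i mod length c)} \<in> E)"

text \<open>The infimum over the empty set makes the girth of a forest \<open>\<infinity>\<close>.\<close>

definition girth :: "'v set set \<Rightarrow> enat" where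
  "girth E = (INF c\<in>{c. is_cycle E c}. enat (length c))"

text \<open>
  A planar drawing in the plane \<open>\<complex>\<close>: \<open>p\<close> places the vertices and \<open>\<gamma> e\<close> is the arc drawn for \<open>e\<close>.
  The last two conditions say that an arc passes through no vertex other than its ends, and that two
  arcs meet only at a common end.
\<close>

definition planar_drawing ::
  "'v set \<Rightarrow> 'v set set \<Rightarrow> ('v \<Rightarrow> complex) \<Rightarrow> ('v set \<Rightarrow> real \<Rightarrow> complex) \<Rightarrow> bool" where
  "planar_drawing V E p \<gamma> \<longleftrightarrow>
     inj_on p V \<and>
     (\<forall>e\<in>E. arc (\<gamma> e) \<and> {pathstart (\<gamma> e), pathfinish (\<gamma> e)} = p ` e) \<and>
     (\<forall>e\<in>E. path_image (\<gamma> e) \<inter> p ` V = p ` e) \<and>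
     (\<forall>e\<in>E. \<forall>e'\<in>E. e \<noteq> e' \<longrightarrow> path_image (\<gamma> e) \<inter> path_image (\<gamma> e') \<subseteq> p ` (e \<inter> e'))"

definition planar_graph :: "'v set \<Rightarrow> 'v set set \<Rightarrow> bool" where
  "planar_graph V E \<longleftrightarrow> (\<exists>p \<gamma>. planar_drawing V E p \<gamma>)"

text \<open>
  The field \<open>\<bbbF>\<^sub>2\<close> is the type \<^typ>\<open>bit\<close>. The dimension \<open>t\<close> of an inversion is the cardinality of the
  index type \<open>'t\<close>.
\<close>

definition is_inversion :: "'v set set \<Rightarrow> ('v set \<Rightarrow> bit) \<Rightarrow> ('v \<Rightarrow> bit ^ 't) \<Rightarrow> bool" where
  "is_inversion E \<pi> f \<longleftrightarrow> (\<forall>u v. {u, v} \<in> E \<longrightarrow> \<pi> {u, v} = scalar_product (f u) (f v))"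

datatype vertex = va | vb | vz | vx nat

definition \<Gamma>_verts :: "vertex set" where
  "\<Gamma>_verts = {va, vb, vz} \<union> vx ` {0..11}"

definition \<Gamma>_edges0 :: "vertex set set" where
  "\<Gamma>_edges0 =
    {{vx 0, va}, {va, vx 2}, {vx 2, vb}, {vb, vx 0}, {vx 0, vx 1},
     {vx 4, vx 3}, {vx 3, va}, {va, vx 5},
     {vx 7, vx 6}, {vx 6, vb}, {vb, vx 8},
     {vx 10, vx 9}}"

definition \<Gamma>_edges1 :: "vertex set set" where
  "\<Gamma>_edges1 =
    {{vz, vx 0}, {vx 1, vx 2},
     {vx 4, vx 5}, {vx 5, vb}, {vb, vx 3},
     {vx 7, vx 8}, {vx 8, va}, {va, vx 6},
     {vx 10, vx 11}, {vx 11, va}, {va, vx 9}, {vx 9, vb}, {vb, vx 11}}"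

definition \<Gamma>_edges :: "vertex set set" where
  "\<Gamma>_edges = \<Gamma>_edges0 \<union> \<Gamma>_edges1"

definition \<Gamma>_color :: "vertex set \<Rightarrow> bit" where
  "\<Gamma>_color e = (if e \<in> \<Gamma>_edges1 then 1 else 0)"

end

theory Submission
  imports Defs
begin

text \<open>
  The colors of \<open>zx\<^sub>0\<close>, \<open>x\<^sub>0x\<^sub>1\<close> and \<open>x\<^sub>1x\<^sub>2\<close> force \<open>x\<^sub>0\<close> and \<open>x\<^sub>2\<close> to be distinct and nonzero, hence
  linearly independent over \<open>\<bbbF>\<^sub>2\<close>. Both are orthogonal to \<open>a\<close> and \<open>b\<close>, so in dimension 3 the vectors
  \<open>a\<close> and \<open>b\<close> lie on a common line. But \<open>ax\<^sub>6\<close>, \<open>bx\<^sub>3\<close> and \<open>x\<^sub>3a\<close> make them nonzero and distinct.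

  The graph is drawn with straight edges: \<open>x\<^sub>i\<close> at \<open>i\<close>, \<open>z\<close> at \<open>-1\<close> and \<open>a\<close>, \<open>b\<close> at \<open>\<i>\<close>, \<open>-\<i>\<close>. Each edge then
  either joins consecutive integers or joins \<open>\<plusminus>\<i>\<close> to an integer. The graph is bipartite, so its girth
  is at least 4.
\<close>

section \<open>Planarity by a straight-line drawing\<close>

text \<open>The segment of an edge is written as a convex hull, which depends only on the set of
  ends and requires no choice of orientation.\<close>

lemma planar_graph_straight_line:
  fixes p :: "'v \<Rightarrow> complex"
  assumes simple: "finite_simple_graph V E" and inj: "inj_on p V"
    and vert: "\<And>e v. e \<in> E \<Longrightarrow> v \<in> V \<Longrightarrow> p v \<in> convex hull (p ` e) \<Longrightarrow> v \<in> e"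
    and cross: "\<And>e e'. e \<in> E \<Longrightarrow> e' \<in> E \<Longrightarrow> e \<noteq> e' \<Longrightarrow>
      convex hull (p ` e) \<inter> convex hull (p ` e') \<subseteq> p ` (e \<inter> e')"
  shows "planar_graph V E"
proof -
  have sub: "e \<subseteq> V" and card: "card e = 2" if "e \<in> E" for e
    using simple that by (simp_all add: finite_simple_graph_def)
  have "\<exists>g. arc g \<and> {pathstart g, pathfinish g} = p ` e \<and> path_image g = convex hull (p ` e)"
    if "e \<in> E" for e
  proof -
    from card[OF that] obtain u v where e: "e = {u, v}" "u \<noteq> v"
      by (auto simp: card_2_iff)
    have "p u \<noteq> p v"
      using inj_on_contraD[OF inj, of u v] sub[OF that] e by simp
    then show ?thesis
      by (intro exI[of _ "linepath (p u) (p v)"]) (simp add: e segment_convex_hull)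
  qed
  then obtain \<gamma> where \<gamma>: "\<And>e. e \<in> E \<Longrightarrow>
    arc (\<gamma> e) \<and> {pathstart (\<gamma> e), pathfinish (\<gamma> e)} = p ` e \<and> path_image (\<gamma> e) = convex hull (p ` e)"
    by metis
  have "convex hull (p ` e) \<inter> p ` V = p ` e" if "e \<in> E" for e
  proof
    show "convex hull (p ` e) \<inter> p ` V \<subseteq> p ` e"
      using vert[OF that] by auto
    show "p ` e \<subseteq> convex hull (p ` e) \<inter> p ` V"
      using sub[OF that] hull_subset[of "p ` e" convex] by auto
  qed
  with inj \<gamma> cross have "planar_drawing V E p \<gamma>"
    unfolding planar_drawing_def by simp
  then show ?thesis
    unfolding planar_graph_def by blast
qed

primrec pos :: "vertex \<Rightarrow> complex" where
  "pos va = \<i>"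
| "pos vb = -\<i>"
| "pos vz = of_int (-1)"
| "pos (vx i) = of_int (int i)"

text \<open>The foot \<open>k\<close> is unrestricted: the geometric lemmas treat all segments from
  \<open>va\<close> or \<open>vb\<close> to a natural number, not only those in the graph.\<close>

definition spoke :: "vertex set \<Rightarrow> vertex \<Rightarrow> nat \<Rightarrow> bool" where
  "spoke e u k \<longleftrightarrow> e = {u, vx k} \<and> u \<in> {va, vb}"

definition axis_edge :: "vertex set \<Rightarrow> int \<Rightarrow> bool" where
  "axis_edge e j \<longleftrightarrow> (\<exists>u v. e = {u, v} \<and> pos u = of_int j \<and> pos v = of_int (j + 1))"

lemma inj_pos: "inj pos"
proof (rule injI)
  fix u v assume "pos u = pos v"
  then show "u = v"
    by (cases u; cases v) (auto simp: complex_eq_iff)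
qed

text \<open>Since \<open>Im (pos u)\<close> is 1 or -1, the product \<open>Im P * Im (pos u)\<close>
  is the weight of the apex \<open>u\<close> in the convex combination \<open>P\<close>. This
  eliminates the segment parameter.\<close>

lemma convex_hull_spoke:
  assumes "spoke e u k" "P \<in> convex hull (pos ` e)"
  shows "Re P = (1 - Im P * Im (pos u)) * k" "0 \<le> Im P * Im (pos u)"
proof -
  from assms have "P \<in> closed_segment (pos u) (pos (vx k))"
    by (simp add: spoke_def segment_convex_hull)
  then obtain t where t: "0 \<le> t" "t \<le> 1" "P = (1 - t) *\<^sub>R pos u + t *\<^sub>R pos (vx k)"
    by (auto simp: closed_segment_def)
  with assms(1) show "Re P = (1 - Im P * Im (pos u)) * k" "0 \<le> Im P * Im (pos u)"
    by (auto simp: spoke_def)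
qed

lemma convex_hull_axis_edge:
  assumes "axis_edge e j" "P \<in> convex hull (pos ` e)"
  shows "Im P = 0" "of_int j \<le> Re P" "Re P \<le> of_int j + 1"
proof -
  from assms have "P \<in> closed_segment (of_real (of_int j)) (of_real (of_int j + 1))"
    by (auto simp: axis_edge_def segment_convex_hull)
  then obtain x where "P = of_real x" "x \<in> closed_segment (of_int j) (of_int j + 1)"
    by (subst (asm) closed_segment_of_real) blast
  then show "Im P = 0" "of_int j \<le> Re P" "Re P \<le> of_int j + 1"
    by (auto simp: closed_segment_eq_real_ivl)
qed

lemma axis_edge_ends:
  assumes "axis_edge e j" "i = j \<or> i = j + 1"
  shows "of_int i \<in> pos ` e"
  using assms by (auto simp: axis_edge_def)

lemma pos_in_convex_hullD:
  assumes e: "spoke e u k \<or> axis_edge e j" and v: "pos v \<in> convex hull (pos ` e)"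
  shows "v \<in> e"
proof -
  have "pos v \<in> pos ` e"
    using e
  proof
    assume s: "spoke e u k"
    show ?thesis
      \<comment> \<open>The sign condition excludes the opposite apex; a vertex on the real axis has
        apex weight 0, hence real part \<open>k\<close>.\<close>
      using convex_hull_spoke[OF s v] s
      by (cases v) (auto simp: spoke_def)
  next
    assume a: "axis_edge e j"
    from convex_hull_axis_edge[OF a v] obtain i where i: "pos v = of_int i"
      by (cases v) (auto simp del: of_int_of_nat_eq intro: that[of "-1"] that)
    have "i = j \<or> i = j + 1"
      using convex_hull_axis_edge[OF a v] unfolding i by (simp; linarith)
    then show ?thesis
      using axis_edge_ends[OF a] i by simp
  qed
  then show ?thesis
    using inj_pos by (simp add: inj_image_mem_iff)
qed

text \<open>It is enough that \<open>P\<close> is the position of an end of one of the two edges: by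
  \<open>pos_in_convex_hullD\<close> that vertex then belongs to both.\<close>

lemma convex_hull_inter_subset:
  assumes e: "spoke e u k \<or> axis_edge e j" and e': "spoke e' u' k' \<or> axis_edge e' j'"
    and ne: "e \<noteq> e'" and P: "P \<in> convex hull (pos ` e)" "P \<in> convex hull (pos ` e')"
  shows "P \<in> pos ` (e \<inter> e')"
proof -
  have "P \<in> pos ` e \<union> pos ` e'"
  proof (cases "spoke e u k \<or> spoke e' u' k'")
    case True
    show ?thesis
    proof (cases "Im P = 0")
      \<comment> \<open>A spoke meets the real axis only at its foot.\<close>
      case True
      with \<open>spoke e u k \<or> spoke e' u' k'\<close> P have "P = pos (vx k) \<and> spoke e u k \<or> P = pos (vx k') \<and> spoke e' u' k'"
        by (auto simp: complex_eq_iff dest: convex_hull_spoke(1))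
      then show ?thesis
        by (auto simp: spoke_def)
    next
      case False
      with e e' P have s: "spoke e u k" "spoke e' u' k'"
        using convex_hull_axis_edge(1) by blast+
      \<comment> \<open>Off the axis, the sign of \<open>Im P\<close> determines the apex.\<close>
      have "u = u'"
        using convex_hull_spoke(2)[OF s(1) P(1)] convex_hull_spoke(2)[OF s(2) P(2)] False s
        by (auto simp: spoke_def)
      moreover from this have "k \<noteq> k'"
        using s ne by (auto simp: spoke_def)
      \<comment> \<open>With equal apex weight \<open>s\<close>, the two values of
        \<open>Re P\<close> give \<open>(1 - s) * k = (1 - s) * k'\<close>, so \<open>s = 1\<close>
        and \<open>P\<close> is the apex.\<close>
      ultimately have "Im P * Im (pos u) = 1"
        using convex_hull_spoke(1)[OF s(1) P(1)] convex_hull_spoke(1)[OF s(2) P(2)] by simp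
      then have "P = pos u"
        using convex_hull_spoke(1)[OF s(1) P(1)] s(1) by (auto simp: spoke_def complex_eq_iff)
      then show ?thesis
        using s(1) by (auto simp: spoke_def)
    qed
  next
    case False
    with e e' have a: "axis_edge e j" "axis_edge e' j'"
      by auto
    have "j \<noteq> j'"
      using a ne inj_pos by (auto simp: axis_edge_def) (metis injD)+
    \<comment> \<open>Distinct unit intervals with integer ends share at most an end.\<close>
    then have "Re P = of_int j \<or> Re P = of_int (j + 1)"
      using convex_hull_axis_edge[OF a(1) P(1)] convex_hull_axis_edge[OF a(2) P(2)] by (simp; linarith)
    then have "P = of_int j \<or> P = of_int (j + 1)"
      using convex_hull_axis_edge(1)[OF a(1) P(1)] by (auto simp: complex_eq_iff)
    then show ?thesis
      using axis_edge_ends[OF a(1)] by blast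
  qed
  then obtain v where v: "P = pos v"
    by blast
  with P have "v \<in> e" "v \<in> e'"
    using pos_in_convex_hullD e e' by auto
  then show ?thesis
    using v by blast
qed

lemma finite_simple_graph_\<Gamma>: "finite_simple_graph \<Gamma>_verts \<Gamma>_edges"
  unfolding finite_simple_graph_def \<Gamma>_verts_def \<Gamma>_edges_def \<Gamma>_edges0_def \<Gamma>_edges1_def ball_Un
  by simp

lemma \<Gamma>_edges_cases: "e \<in> \<Gamma>_edges \<Longrightarrow> \<exists>u k j. spoke e u k \<or> axis_edge e j"
proof -
  assume e: "e \<in> \<Gamma>_edges"
  have spokes: "\<exists>u k j. spoke {vx i, w} u k \<or> axis_edge {vx i, w} j"
    "\<exists>u k j. spoke {w, vx i} u k \<or> axis_edge {w, vx i} j" if "w \<in> {va, vb}" for i w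
    using that by (force simp: spoke_def)+
  have axis: "\<exists>u k j. spoke {v, w} u k \<or> axis_edge {v, w} j"
    "\<exists>u k j. spoke {w, v} u k \<or> axis_edge {w, v} j"
    if "pos v = of_int i" "pos w = of_int (i + 1)" for v w i
    using that unfolding axis_edge_def by (metis insert_commute)+
  \<comment> \<open>These are the nine edges on the real axis. The numbers supplied below are their
    left ends; \<open>axis(2)\<close> serves those listed with the right end first.\<close>
  have *: "\<exists>u k j. spoke {vx 4, vx 3} u k \<or> axis_edge {vx 4, vx 3} j"
    "\<exists>u k j. spoke {vx 7, vx 6} u k \<or> axis_edge {vx 7, vx 6} j"
    "\<exists>u k j. spoke {vx 10, vx 9} u k \<or> axis_edge {vx 10, vx 9} j"
    "\<exists>u k j. spoke {vz, vx 0} u k \<or> axis_edge {vz, vx 0} j"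
    "\<exists>u k j. spoke {vx 0, vx 1} u k \<or> axis_edge {vx 0, vx 1} j"
    "\<exists>u k j. spoke {vx 1, vx 2} u k \<or> axis_edge {vx 1, vx 2} j"
    "\<exists>u k j. spoke {vx 4, vx 5} u k \<or> axis_edge {vx 4, vx 5} j"
    "\<exists>u k j. spoke {vx 7, vx 8} u k \<or> axis_edge {vx 7, vx 8} j"
    "\<exists>u k j. spoke {vx 10, vx 11} u k \<or> axis_edge {vx 10, vx 11} j"
    by (rule axis(2)[of _ 3] axis(2)[of _ 6] axis(2)[of _ 9]
      axis(1)[of _ "-1"] axis(1)[of _ 0] axis(1)[of _ 1] axis(1)[of _ 4] axis(1)[of _ 7]
      axis(1)[of _ 10]; simp; fail)+
  show ?thesis
    using e unfolding \<Gamma>_edges_def \<Gamma>_edges0_def \<Gamma>_edges1_def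
    by (elim UnE insertE emptyE; hypsubst) (rule *; fail | rule spokes; simp; fail)+
qed

lemma planar_graph_\<Gamma>: "planar_graph \<Gamma>_verts \<Gamma>_edges"
proof (rule planar_graph_straight_line[of _ _ pos])
  show "inj_on pos \<Gamma>_verts"
    using inj_pos by (rule inj_on_subset) simp
  show "v \<in> e" if "e \<in> \<Gamma>_edges" "pos v \<in> convex hull (pos ` e)" for e v
    using \<Gamma>_edges_cases[OF that(1)] pos_in_convex_hullD that(2) by blast
  show "convex hull (pos ` e) \<inter> convex hull (pos ` e') \<subseteq> pos ` (e \<inter> e')"
    if "e \<in> \<Gamma>_edges" "e' \<in> \<Gamma>_edges" "e \<noteq> e'" for e e'
    using \<Gamma>_edges_cases[OF that(1)] \<Gamma>_edges_cases[OF that(2)] convex_hull_inter_subset that(3)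
    by blast
qed (rule finite_simple_graph_\<Gamma>)

section \<open>Girth\<close>

text \<open>Two of the three vertices of a triangle would lie on the same side of the bipartition
  into \<open>S\<close> and its complement.\<close>

lemma girth_ge_4_bipartite:
  assumes "\<And>e. e \<in> E \<Longrightarrow> e \<inter> S \<noteq> {} \<and> \<not> e \<subseteq> S"
  shows "4 \<le> girth E"
  unfolding girth_def
proof (rule INF_greatest)
  fix c assume "c \<in> {c. is_cycle E c}"
  then have c: "3 \<le> length c" "\<And>i. i < length c \<Longrightarrow> {c ! i, c ! (Suc i mod length c)} \<in> E"
    by (auto simp: is_cycle_def)
  have "length c \<noteq> 3"
  proof
    assume l: "length c = 3"
    have "{c ! 0, c ! 1} \<in> E" "{c ! 1, c ! 2} \<in> E" "{c ! 2, c ! 0} \<in> E"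
      using c(2)[of 0] c(2)[of 1] c(2)[of 2] by (simp_all add: l numeral_2_eq_2)
    from this[THEN assms] show False
      by blast
  qed
  with c(1) have "4 \<le> length c"
    by simp
  then show "4 \<le> enat (length c)"
    by (simp add: numeral_eq_enat)
qed

lemma girth_\<Gamma>: "girth \<Gamma>_edges = 4"
proof (rule antisym)
  have "is_cycle \<Gamma>_edges [va, vx 0, vb, vx 2]"
    unfolding is_cycle_def \<Gamma>_edges_def \<Gamma>_edges0_def
    by (simp add: All_less_Suc doubleton_eq_iff)
  then have "girth \<Gamma>_edges \<le> enat (length [va, vx 0, vb, vx 2])"
    unfolding girth_def by (intro INF_lower) simp
  also have "length [va, vx 0, vb, vx 2] = 4"
    by simp
  finally show "girth \<Gamma>_edges \<le> 4"
    by (simp add: numeral_eq_enat)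
  \<comment> \<open>This side of the bipartition consists of the neighbors of \<open>va\<close> and
    \<open>vb\<close>.\<close>
  have "\<forall>e\<in>\<Gamma>_edges. e \<inter> vx ` {0, 2, 3, 5, 6, 8, 9, 11} \<noteq> {} \<and> \<not> e \<subseteq> vx ` {0, 2, 3, 5, 6, 8, 9, 11}"
    unfolding \<Gamma>_edges_def \<Gamma>_edges0_def \<Gamma>_edges1_def ball_Un by simp
  then show "4 \<le> girth \<Gamma>_edges"
    by (intro girth_ge_4_bipartite) blast
qed

section \<open>Nonexistence of a 3-inversion\<close>

text \<open>The orthogonal complement of two independent vectors in dimension 3 is a line, which
  over the field of two elements has a single nonzero vector.\<close>

lemma orthogonal_to_two_bit3:
  fixes x y a b :: "bit ^ 3"
  assumes "x \<noteq> 0" "y \<noteq> 0" "x \<noteq> y"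
    and "scalar_product x a = 0" "scalar_product y a = 0"
    and "scalar_product x b = 0" "scalar_product y b = 0"
  shows "a = 0 \<or> b = 0 \<or> a = b"
proof -
  \<comment> \<open>Reading each coordinate as a truth value turns the claim into a propositional
    formula in twelve atoms, which \<open>argo\<close> decides.\<close>
  have bit: "s + t = 0 \<longleftrightarrow> (s = 0 \<longleftrightarrow> t = 0)" for s t :: bit
    by (cases s; cases t; simp)
  have index: "v $ i = w $ i \<longleftrightarrow> (v $ i = 0 \<longleftrightarrow> w $ i = 0)" for v w :: "bit ^ 3" and i
    by (cases "v $ i"; cases "w $ i"; simp)
  show ?thesis
    using assms unfolding vec_eq_iff forall_3 scalar_product_def sum_3
    by (simp only: bit index mult_eq_0_iff zero_index simp_thms) argo
qed

lemma no_inversion_\<Gamma>: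
  fixes f :: "vertex \<Rightarrow> bit ^ 3"
  shows "\<not> is_inversion \<Gamma>_edges \<Gamma>_color f"
proof
  assume inv: "is_inversion \<Gamma>_edges \<Gamma>_color f"
  have c1: "scalar_product (f u) (f v) = 1" if "{u, v} \<in> \<Gamma>_edges1" for u v
    using inv that by (auto simp: is_inversion_def \<Gamma>_edges_def \<Gamma>_color_def)
  have c0: "scalar_product (f u) (f v) = 0" if "{u, v} \<in> \<Gamma>_edges0" "{u, v} \<notin> \<Gamma>_edges1" for u v
    using inv that unfolding is_inversion_def \<Gamma>_edges_def \<Gamma>_color_def by (metis UnI1)
  note defs = \<Gamma>_edges0_def \<Gamma>_edges1_def doubleton_eq_iff
  have sym: "scalar_product u v = scalar_product v u" for u v :: "bit ^ 3"
    unfolding scalar_product_def by (rule sum.cong) (simp_all only: mult.commute)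
  have zero: "scalar_product 0 v = 0" "scalar_product v 0 = 0" for v :: "bit ^ 3"
    by (simp_all add: scalar_product_def)
  have "f (vx 0) \<noteq> 0" "f (vx 2) \<noteq> 0"
    using c1[of vz "vx 0"] c1[of "vx 1" "vx 2"] zero by (auto simp: defs)
  \<comment> \<open>The vector of \<open>vx 1\<close> is orthogonal to that of \<open>vx 0\<close>
    but not to that of \<open>vx 2\<close>.\<close>
  moreover have "f (vx 0) \<noteq> f (vx 2)"
    using c0[of "vx 0" "vx 1"] c1[of "vx 1" "vx 2"] sym by (auto simp: defs)
  moreover have "scalar_product (f (vx i)) (f w) = 0" if "i \<in> {0, 2}" "w \<in> {va, vb}" for i w
    using that by (auto intro!: c0 simp: defs)
  ultimately have "f va = 0 \<or> f vb = 0 \<or> f va = f vb"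
    using orthogonal_to_two_bit3[of "f (vx 0)" "f (vx 2)" "f va" "f vb"] by auto
  moreover have "f va \<noteq> 0" "f vb \<noteq> 0"
    using c1[of va "vx 6"] c1[of vb "vx 3"] zero by (auto simp: defs)
  \<comment> \<open>Here \<open>vx 3\<close> separates the two, its edges to \<open>va\<close> and
    \<open>vb\<close> having different colors.\<close>
  moreover have "f va \<noteq> f vb"
    using c0[of "vx 3" va] c1[of "vx 3" vb] by (auto simp: defs)
  ultimately show False
    by blast
qed

theorem proposition4p5:
  "finite_simple_graph \<Gamma>_verts \<Gamma>_edges \<and>
   planar_graph \<Gamma>_verts \<Gamma>_edges \<and>
   girth \<Gamma>_edges = 4 \<and>
   \<not> (\<exists>f :: vertex \<Rightarrow> bit ^ 3. is_inversion \<Gamma>_edges \<Gamma>_color f)"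
  using finite_simple_graph_\<Gamma> planar_graph_\<Gamma> girth_\<Gamma> no_inversion_\<Gamma> by blast

end
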